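(* Let $G$ be a fixed $3$-regular graph on $k$ vertices. The maximum number of unit distance subgraphs isomorphic to $G$ determined by a set of $n$ points in $\mathbb{R}^3$ is $\tilde{O}\left(n^{k/2}\right)$ as $n\to\infty$.
   Context: Graphs are finite and simple. For a finite set $P\subseteq\mathbb{R}^3$, the unit distance graph of $P$ has vertex set $P$, with two points joined by an edge if and only if their Euclidean distance is $1$. A unit distance subgraph isomorphic to $G$ determined by $P$ is a (not necessarily induced) subgraph of the unit distance graph of $P$ that is isomorphic to $G$. The maximum is over all sets $P$ of $n$ points in $\mathbb{R}^3$. Notation: $\tilde{O}$ hides polylogarithmic factors, i.e. $f(n)=\tilde{O}(g(n))$ means that there are constants $C,c>0$ (which may depend on $G$) such that $f(n)\le C\,g(n)(\log n)^{c}$ for all sufficiently large $n$. *)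

theory Defs
  imports "HOL-Analysis.Analysis" "Graph_Theory.Digraph_Isomorphism"
begin

(* A finite simple graph is a pair_graph: its parcs form a symmetric irreflexive relation on its
   vertices, an edge {u,v} being the two arcs (u,v) and (v,u).  Hence the number of edges at v is
   the out-degree of v. *)

definition regular :: "nat \<Rightarrow> 'a pair_pre_digraph \<Rightarrow> bool" where
  "regular d G \<longleftrightarrow> (\<forall>v \<in> pverts G. out_degree (with_proj G) v = d)"

definition unit_distance_graph :: "'a::metric_space set \<Rightarrow> 'a pair_pre_digraph" where
  "unit_distance_graph P =
     \<lparr> pverts = P, parcs = {(x, y). x \<in> P \<and> y \<in> P \<and> dist x y = 1} \<rparr>"

(* Copies are subgraphs, not embeddings: each is counted once, whatever the automorphisms of G.
   Only symmetric H occur here, since being isomorphic to a symmetric digraph forces symmetry. *)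
definition unit_distance_copies ::
    "'a pair_pre_digraph \<Rightarrow> 'b::metric_space set \<Rightarrow> 'b pair_pre_digraph set" where
  "unit_distance_copies G P =
     {H. subgraph (with_proj H) (with_proj (unit_distance_graph P)) \<and>
         digraph_iso (with_proj G) (with_proj H)}"

definition max_unit_distance_copies :: "'a pair_pre_digraph \<Rightarrow> nat \<Rightarrow> nat" where
  "max_unit_distance_copies G n =
     Max {card (unit_distance_copies G P) | P :: (real ^ 3) set. finite P \<and> card P = n}"

definition soft_bigo :: "(nat \<Rightarrow> real) \<Rightarrow> (nat \<Rightarrow> real) set" where
  "soft_bigo g = {f. \<exists>C > 0. \<exists>c > 0.
     eventually (\<lambda>n. f n \<le> C * g n * ln (real n) powr c) sequentially}"

lemma pair_graph_unit_distance_graph: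
  assumes "finite P"
  shows "pair_graph (unit_distance_graph P)"
proof -
  have "finite {(x, y). x \<in> P \<and> y \<in> P \<and> dist x y = 1}"
    by (rule finite_subset[of _ "P \<times> P"]) (use assms in auto)
  with assms show ?thesis
    by unfold_locales
      (auto simp: unit_distance_graph_def symmetric_def dist_commute intro!: symI)
qed

lemma digraph_iso_with_proj_iff:
  assumes "pair_wf_digraph G"
  shows "digraph_iso (with_proj G) (with_proj H) \<longleftrightarrow>
    (\<exists>f. inj_on f (pverts G) \<and> pverts H = f ` pverts G \<and> parcs H = map_prod f f ` parcs G)"
    (is "?L \<longleftrightarrow> ?R")
proof
  assume ?L
  then obtain h where h: "pre_digraph.digraph_isomorphism (with_proj G) h"
    and H: "with_proj H = app_iso h (with_proj G)"
    by (auto simp: digraph_iso_def)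
  from H have eqs: "pverts H = iso_verts h ` pverts G" "parcs H = iso_arcs h ` parcs G"
    "iso_tail h = fst" "iso_head h = snd"
    by (auto simp: with_proj_def app_iso_def)
  have "iso_arcs h a = map_prod (iso_verts h) (iso_verts h) a" if "a \<in> parcs G" for a
    using h that eqs by (cases a) (auto simp: pre_digraph.digraph_isomorphism_def prod_eq_iff)
  then have "parcs H = map_prod (iso_verts h) (iso_verts h) ` parcs G"
    using eqs by (auto simp: image_iff)
  then show ?R
    using h eqs by (auto simp: pre_digraph.digraph_isomorphism_def)
next
  assume ?R
  then obtain f where f: "inj_on f (pverts G)" "pverts H = f ` pverts G"
    "parcs H = map_prod f f ` parcs G"
    by blast
  let ?h = "\<lparr> iso_verts = f, iso_arcs = map_prod f f, iso_head = snd, iso_tail = fst \<rparr>"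
  have wf: "wf_digraph (with_proj G)"
    using assms by (simp add: wf_digraph_wp_iff)
  have "parcs G \<subseteq> pverts G \<times> pverts G"
    using assms by (auto simp: pair_wf_digraph_def)
  then have "inj_on (map_prod f f) (parcs G)"
    using f(1) by (auto simp: inj_on_def subset_iff)
  then have "pre_digraph.digraph_isomorphism (with_proj G) ?h"
    using wf f(1) by (auto simp: pre_digraph.digraph_isomorphism_def)
  moreover have "with_proj H = app_iso ?h (with_proj G)"
    using f by (simp add: with_proj_def app_iso_def)
  ultimately show ?L
    unfolding digraph_iso_def by blast
qed

lemma finite_nonempty_unit_distance_counts:
  "finite {card (unit_distance_copies G P) | P :: (real ^ 3) set. finite P \<and> card P = n}"
    (is "finite ?S")
  "{card (unit_distance_copies G P) | P :: (real ^ 3) set. finite P \<and> card P = n} \<noteq> {}"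
proof -
  have "card (unit_distance_copies G P) \<le> 2 ^ n * 2 ^ (n * n)"
    if P: "finite P" "card P = n" for P :: "(real ^ 3) set"
  proof -
    let ?g = "\<lambda>(V, A). \<lparr> pverts = V, parcs = A \<rparr> :: (real ^ 3) pair_pre_digraph"
    have "unit_distance_copies G P \<subseteq> ?g ` (Pow P \<times> Pow (P \<times> P))"
    proof
      fix H assume "H \<in> unit_distance_copies G P"
      then have "pverts H \<subseteq> P" "parcs H \<subseteq> P \<times> P"
        by (auto simp: unit_distance_copies_def subgraph_def unit_distance_graph_def)
      then show "H \<in> ?g ` (Pow P \<times> Pow (P \<times> P))"
        by (intro image_eqI[of _ _ "(pverts H, parcs H)"]) auto
    qed
    moreover have "finite (Pow P \<times> Pow (P \<times> P))"
      using P by simp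
    ultimately have "card (unit_distance_copies G P) \<le> card (Pow P \<times> Pow (P \<times> P))"
      by (rule surj_card_le[rotated])
    then show ?thesis
      using P by (simp add: card_cartesian_product card_Pow)
  qed
  then have "?S \<subseteq> {..2 ^ n * 2 ^ (n * n)}"
    by auto
  then show "finite ?S"
    using finite_subset by blast
  obtain P :: "(real ^ 3) set" where "finite P" "card P = n"
    using infinite_arbitrarily_large[of "UNIV :: (real ^ 3) set" n]
      finite_imp_bounded[of "UNIV :: (real ^ 3) set"] not_bounded_UNIV
    by blast
  then show "?S \<noteq> {}"
    by blast
qed

end

theory Submission
  imports Defs
begin

text \<open>
  The unit distance graph of a set of $n$ points in space contains no $K_{3,3}$, and this is all that
  is used; no logarithmic factor is lost. Counting $K_{2,3}$'s gives $\sum_{x,y} c(x,y)^2 = O(n^{8/3})$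
  for the codegrees $c(x,y)$, whence the adjacency operator has norm $O(\lambda)$ for
  $\lambda = n^{2/3}$, and counting inside neighbourhoods gives $O(n^2)$ triangles. We claim that a
  pattern with $k$ vertices, $e$ edges and maximum degree at most 3 has $O(n^{k - e/3})$ copies, which
  is $n^{k/2}$ for a cubic pattern. Deleting a vertex of degree 3 costs only a factor 2, since
  three distinct points have at most two common neighbours, and preserves $k - e/3$. Once all degrees
  are at most 2, the pattern is a union of paths and cycles and all homomorphisms are counted:
  leaves are removed by the operator norm bound, triangles by the triangle bound, and a longer
  cycle by fixing the image of a vertex and removing it together with its two neighbours, which
  puts codegrees on the two vertices next to them.
\<close>

section \<open>Geometry: unit distances in space contain no K_{3,3}\<close>

text \<open>A line meets a sphere in at most two points. If \<open>e = s d\<close>, comparing the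
  three norm equations leaves \<open>s (s - 1) (d \<bullet> d) = 0\<close>, so that two of the three
  points coincide.\<close>

lemma not_collinear_sphere:
  fixes x d e :: "'a::euclidean_space"
  assumes "norm x = 1" "norm (x + d) = 1" "norm (x + e) = 1" "d \<noteq> 0" "e \<noteq> 0" "d \<noteq> e"
  shows "\<not> collinear {0, d, e}"
proof
  assume "collinear {0, d, e}"
  then obtain s where s: "e = s *\<^sub>R d" using assms by (auto simp: collinear_lemma)
  have "x \<bullet> x = 1" "(x + d) \<bullet> (x + d) = 1" "(x + e) \<bullet> (x + e) = 1"
    using assms(1-3) by (simp_all add: dot_square_norm)
  then have 1: "2 * (x \<bullet> d) + d \<bullet> d = 0" "2 * s * (x \<bullet> d) + s * s * (d \<bullet> d) = 0"
    by (simp_all add: s inner_add_left inner_add_right inner_commute algebra_simps)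
  then have "s * (s - 1) * (d \<bullet> d) = 0" by algebra
  then show False using assms s by auto
qed

text \<open>Differences within one side of a K_{3,3} are orthogonal to differences within the other.
  As \<open>p\<close>, \<open>q\<close>, \<open>r\<close> lie on a unit sphere, they span a plane;
  \<open>b - a\<close> and \<open>c - a\<close> are both parallel to its normal \<open>m\<close>,
  which makes \<open>a\<close>, \<open>b\<close>, \<open>c\<close> collinear although they too lie
  on a unit sphere.\<close>

lemma unit_distance_no_K33:
  fixes a b c p q r :: "real ^ 3"
  assumes "a \<noteq> b" "a \<noteq> c" "b \<noteq> c" "p \<noteq> q" "p \<noteq> r" "q \<noteq> r"
    and d: "dist a p = 1" "dist a q = 1" "dist a r = 1"
      "dist b p = 1" "dist b q = 1" "dist b r = 1" "dist c p = 1" "dist c q = 1" "dist c r = 1"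
  shows False
proof -
  have orth: "(v - u) \<bullet> (y - x) = 0"
    if "dist u x = 1" "dist u y = 1" "dist v x = 1" "dist v y = 1" for u v x y :: "real ^ 3"
  proof -
    have "(u - x) \<bullet> (u - x) = 1" "(u - y) \<bullet> (u - y) = 1" "(v - x) \<bullet> (v - x) = 1" "(v - y) \<bullet> (v - y) = 1"
      using that by (simp_all add: dist_norm dot_square_norm)
    then show ?thesis by (simp add: inner_diff_left inner_diff_right inner_commute)
  qed
  define m where "m = cross3 (q - p) (r - p)"
  have "\<not> collinear {0, q - p, r - p}"
    using assms by (intro not_collinear_sphere[of "p - a"]) (auto simp: dist_norm norm_minus_commute)
  then have m: "m \<noteq> 0" by (simp add: m_def cross_eq_0)
  have "\<not> collinear {0, b - a, c - a}"
    using assms by (intro not_collinear_sphere[of "a - p"]) (auto simp: dist_norm norm_minus_commute)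
  moreover have "cross3 m e = 0" if "e = b - a \<or> e = c - a" for e
  proof -
    have "e \<bullet> (q - p) = 0" "e \<bullet> (r - p) = 0" using that d by (auto intro: orth)
    \<comment> \<open>The triple product formula writes \<open>cross3 e m\<close> as a combination
      of \<open>q - p\<close> and \<open>r - p\<close> whose coefficients are, up to sign, the two
      inner products just shown to vanish.\<close>
    then have "cross3 e m = 0" by (simp add: m_def Lagrange)
    then show ?thesis by (metis cross_skew neg_equal_0_iff_equal)
  qed
  then obtain s t where "b - a = s *\<^sub>R m" "c - a = t *\<^sub>R m"
    using m by (metis collinear_lemma cross_eq_0 scaleR_zero_left)
  then have "cross3 (b - a) (c - a) = 0" by (simp add: cross_mult_left cross_mult_right)
  ultimately show False by (simp add: cross_eq_0)
qed

lemma card_common_unit_neighbours_le: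
  fixes a b c :: "real ^ 3"
  assumes "finite P" "a \<noteq> b" "a \<noteq> c" "b \<noteq> c"
  shows "card {p \<in> P. dist a p = 1 \<and> dist b p = 1 \<and> dist c p = 1} \<le> 2" (is "card ?S \<le> 2")
proof (rule ccontr)
  assume "\<not> card ?S \<le> 2"
  then have "3 \<le> card ?S" by simp
  then obtain T where T: "T \<subseteq> ?S" "card T = 3" by (meson obtain_subset_with_card_n)
  then obtain p q r where "T = {p, q, r}" "p \<noteq> q" "p \<noteq> r" "q \<noteq> r" by (auto simp: card_3_iff)
  then show False using unit_distance_no_K33[of a b c p q r] T assms by auto
qed

lemma sum_rotate: "(\<Sum>x\<in>X. \<Sum>y\<in>Y. \<Sum>p\<in>Z. f x y p) = (\<Sum>p\<in>Z. \<Sum>x\<in>X. \<Sum>y\<in>Y. f x y p)"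
  by (simp only: sum.swap[of _ Z])

section \<open>Codegree moments, triangles and the operator norm of a K_{3,3}-free graph\<close>

locale host_graph =
  fixes P :: "'b set" and A :: "'b \<Rightarrow> 'b \<Rightarrow> bool"
  assumes finite_P [simp]: "finite P"
    and nonempty_P: "P \<noteq> {}"
    and A_sym: "A x y \<Longrightarrow> A y x"
    and A_irrefl: "\<not> A x x"
    and common_neighbours:
      "\<lbrakk>x \<in> P; y \<in> P; z \<in> P; x \<noteq> y; x \<noteq> z; y \<noteq> z\<rbrakk>
        \<Longrightarrow> card {p \<in> P. A x p \<and> A y p \<and> A z p} \<le> 2"
begin

definition adj :: "'b \<Rightarrow> 'b \<Rightarrow> real" where
  "adj x y = of_bool (A x y)"

text \<open>By symmetry this is the square of the adjacency matrix. The diagonal is kept: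
  \<open>codeg x x\<close> is the degree of \<open>x\<close>.\<close>

definition codeg :: "'b \<Rightarrow> 'b \<Rightarrow> real" where
  "codeg x y = (\<Sum>z\<in>P. adj x z * adj y z)"

lemma adj_commute: "adj x y = adj y x"
  using A_sym by (auto simp: adj_def)

lemma adj_nonneg [simp]: "0 \<le> adj x y"
  and adj_idem [simp]: "adj x y * adj x y = adj x y"
  by (simp_all add: adj_def)

lemma adj_idem_left [simp]: "adj x y * (adj x y * r) = adj x y * r"
  by (simp add: adj_def)

lemma codeg_nonneg [simp]: "0 \<le> codeg x y"
  by (simp add: codeg_def sum_nonneg)

abbreviation N :: real where "N \<equiv> real (card P)"

lemma N_ge_1: "1 \<le> N"
  using nonempty_P by (simp add: Suc_leI card_gt_0_iff)

lemma triple_le_2: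
  assumes "x \<in> P" "y \<in> P" "z \<in> P" "x \<noteq> y" "x \<noteq> z" "y \<noteq> z"
  shows "(\<Sum>p\<in>P. adj x p * adj y p * adj z p) \<le> 2"
proof -
  have "(\<Sum>p\<in>P. adj x p * adj y p * adj z p) = real (card {p \<in> P. A x p \<and> A y p \<and> A z p})"
    by (simp add: adj_def flip: of_bool_conj sum.inter_filter) (simp add: conj_assoc of_bool_def sum.If_cases Int_def)
  then show ?thesis
    using common_neighbours[OF assms] by simp
qed

text \<open>Double counting of pairs \<open>x\<close>, \<open>y\<close> with three common neighbours
  \<open>p\<close>, \<open>q\<close>, \<open>r\<close>, repetitions allowed. Seen from the triple,
  the count is the square of its number of common neighbours: at most 4 if the triple is distinct,
  and a squared codegree for each of the three ways in which two entries can coincide.\<close>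

lemma sum_codeg_cube_le:
  "(\<Sum>x\<in>P. \<Sum>y\<in>P. codeg x y ^ 3) \<le> 4 * N ^ 3 + 3 * (\<Sum>x\<in>P. \<Sum>y\<in>P. (codeg x y)\<^sup>2)"
proof -
  define h where "h p q r = (\<Sum>x\<in>P. adj p x * adj q x * adj r x)" for p q r
  let ?F = "\<lambda>x y p q r. (adj p x * adj q x * adj r x) * (adj p y * adj q y * adj r y)"
  have "(\<Sum>x\<in>P. \<Sum>y\<in>P. codeg x y ^ 3) =
      (\<Sum>x\<in>P. \<Sum>y\<in>P. \<Sum>p\<in>P. \<Sum>q\<in>P. \<Sum>r\<in>P. ?F x y p q r)"
    by (simp add: codeg_def power3_eq_cube sum_product sum_distrib_left sum_distrib_right mult_ac
        adj_commute[of _ "_"])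
  also have "\<dots> = (\<Sum>p\<in>P. \<Sum>x\<in>P. \<Sum>y\<in>P. \<Sum>q\<in>P. \<Sum>r\<in>P. ?F x y p q r)"
    by (rule sum_rotate)
  also have "\<dots> = (\<Sum>p\<in>P. \<Sum>q\<in>P. \<Sum>x\<in>P. \<Sum>y\<in>P. \<Sum>r\<in>P. ?F x y p q r)"
    by (intro sum.cong refl sum_rotate)
  also have "\<dots> = (\<Sum>p\<in>P. \<Sum>q\<in>P. \<Sum>r\<in>P. \<Sum>x\<in>P. \<Sum>y\<in>P. ?F x y p q r)"
    by (intro sum.cong refl sum_rotate)
  also have "\<dots> = (\<Sum>p\<in>P. \<Sum>q\<in>P. \<Sum>r\<in>P. (h p q r)\<^sup>2)"
    by (simp add: h_def power2_eq_square sum_product)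
  also have "\<dots> \<le> (\<Sum>p\<in>P. \<Sum>q\<in>P. \<Sum>r\<in>P. 4 + of_bool (p = q) * (codeg p r)\<^sup>2
      + of_bool (p = r) * (codeg p q)\<^sup>2 + of_bool (q = r) * (codeg p q)\<^sup>2)"
  proof (intro sum_mono)
    fix p q r assume P: "p \<in> P" "q \<in> P" "r \<in> P"
    have h0: "0 \<le> h p q r" by (simp add: h_def sum_nonneg)
    consider "p = q" | "p = r" | "q = r" | "p \<noteq> q" "p \<noteq> r" "q \<noteq> r" by blast
    then show "(h p q r)\<^sup>2 \<le> 4 + of_bool (p = q) * (codeg p r)\<^sup>2
      + of_bool (p = r) * (codeg p q)\<^sup>2 + of_bool (q = r) * (codeg p q)\<^sup>2"
    proof cases
      case 4
      then have "h p q r \<le> 2" using triple_le_2 P by (simp add: h_def)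
      then have "(h p q r)\<^sup>2 \<le> 2\<^sup>2" using h0 by (rule power_mono)
      then show ?thesis using 4 by simp
    qed (auto simp: h_def codeg_def mult_ac)
  qed
  also have "\<dots> = 4 * N ^ 3 + 3 * (\<Sum>x\<in>P. \<Sum>y\<in>P. (codeg x y)\<^sup>2)"
  proof -
    have "(\<Sum>q\<in>P. \<Sum>r\<in>P. of_bool (p = q) * (codeg p r)\<^sup>2) = (\<Sum>r\<in>P. (codeg p r)\<^sup>2)"
      if "p \<in> P" for p
      using that by (simp flip: sum_distrib_left)
    then show ?thesis
      by (simp add: sum.distrib power3_eq_cube sum_distrib_left[symmetric] sum_distrib_right[symmetric])
  qed
  finally show ?thesis .
qed

definition cbrt :: real where "cbrt = N powr (1/3)"

lemma cbrt_ge_1: "1 \<le> cbrt"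
  using N_ge_1 by (simp add: cbrt_def ge_one_powr_ge_zero)

lemma cbrt_cube: "cbrt ^ 3 = N"
proof -
  have "cbrt ^ 3 = cbrt powr 3" using cbrt_ge_1 by simp
  then show ?thesis using N_ge_1 by (simp add: cbrt_def powr_powr)
qed

text \<open>Split at the threshold \<open>s\<close>: above it the first summand suffices, below it
  the second. This and the next lemma pass from a higher moment to a lower one, with
  \<open>s\<close> free to be optimised.\<close>

lemma square_le_cube_div: "c\<^sup>2 \<le> c ^ 3 / s + s\<^sup>2" if "0 \<le> c" "0 < s" for c s :: real
proof (cases "s \<le> c")
  case True
  then have "s * c\<^sup>2 \<le> c * c\<^sup>2" by (intro mult_right_mono) auto
  then have "c\<^sup>2 \<le> c ^ 3 / s" using that by (simp add: field_simps power3_eq_cube power2_eq_square)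
  then show ?thesis by (simp add: add_increasing2)
next
  case False
  then have "c\<^sup>2 \<le> s\<^sup>2" using that by (intro power_mono) auto
  then show ?thesis using that by (simp add: add_increasing)
qed

lemma le_square_div: "c \<le> c\<^sup>2 / s + s" if "0 \<le> c" "0 < s" for c s :: real
proof (cases "s \<le> c")
  case True
  then have "s * c \<le> c * c" using that by (intro mult_right_mono) auto
  then have "c \<le> c\<^sup>2 / s" using that by (simp add: field_simps power2_eq_square)
  then show ?thesis using that by simp
next
  case False
  then show ?thesis using that by (simp add: add_increasing)
qed

text \<open>The third moment is bounded in terms of the second, so the second moment bounds itself.
  Both remaining terms, \<open>N ^ 3 / cbrt\<close> and \<open>N\<^sup>2 * cbrt\<^sup>2\<close>,
  have order \<open>cbrt ^ 8\<close>.\<close>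

lemma sum_codeg_square_le: "(\<Sum>x\<in>P. \<Sum>y\<in>P. (codeg x y)\<^sup>2) \<le> 74 * cbrt ^ 8"
proof -
  let ?T = "\<Sum>x\<in>P. \<Sum>y\<in>P. (codeg x y)\<^sup>2"
  have t: "1 \<le> cbrt" by (rule cbrt_ge_1)
  have T0: "0 \<le> ?T" by (intro sum_nonneg) auto
  \<comment> \<open>The factor 6 in the threshold turns the term \<open>3 * ?T\<close> of the third
    moment into at most \<open>?T / 2\<close>, which is then absorbed on the left.\<close>
  have "?T \<le> (\<Sum>x\<in>P. \<Sum>y\<in>P. codeg x y ^ 3 / (6 * cbrt) + (6 * cbrt)\<^sup>2)"
    using t by (intro sum_mono square_le_cube_div) auto
  also have "\<dots> = (\<Sum>x\<in>P. \<Sum>y\<in>P. codeg x y ^ 3) / (6 * cbrt) + N\<^sup>2 * (6 * cbrt)\<^sup>2"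
    by (simp add: sum.distrib sum_divide_distrib power2_eq_square)
  also have "\<dots> \<le> (4 * N ^ 3 + 3 * ?T) / (6 * cbrt) + N\<^sup>2 * (6 * cbrt)\<^sup>2"
    using t by (intro add_right_mono divide_right_mono sum_codeg_cube_le) auto
  also have "\<dots> = 4 * N ^ 3 / (6 * cbrt) + ?T / (2 * cbrt) + N\<^sup>2 * (6 * cbrt)\<^sup>2"
    using t by (simp add: add_divide_distrib)
  also have "4 * N ^ 3 / (6 * cbrt) = 2 / 3 * cbrt ^ 8"
    using t by (simp add: cbrt_cube[symmetric] field_simps eval_nat_numeral)
  also have "N\<^sup>2 * (6 * cbrt)\<^sup>2 = 36 * cbrt ^ 8"
    by (simp add: cbrt_cube[symmetric] eval_nat_numeral)
  also have "?T / (2 * cbrt) \<le> ?T / 2"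
    using t T0 by (intro divide_left_mono) auto
  finally have "?T \<le> 2 * (2 / 3 * cbrt ^ 8 + 36 * cbrt ^ 8)" by simp
  also have "\<dots> \<le> 74 * cbrt ^ 8" using t by simp
  finally show ?thesis .
qed

definition valency :: "'b \<Rightarrow> real" where
  "valency x = (\<Sum>y\<in>P. adj x y)"

lemma valency_nonneg [simp]: "0 \<le> valency x"
  by (simp add: valency_def sum_nonneg)

text \<open>Paths of length two, counted by their middle vertex on the left, are counted by their
  two ends as a sum of codegrees.\<close>

lemma sum_valency_square_le: "(\<Sum>x\<in>P. (valency x)\<^sup>2) \<le> 75 * cbrt ^ 7"
proof -
  have t: "1 \<le> cbrt" by (rule cbrt_ge_1)
  have "(\<Sum>z\<in>P. (valency z)\<^sup>2) = (\<Sum>z\<in>P. \<Sum>x\<in>P. \<Sum>y\<in>P. adj x z * adj y z)"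
    by (simp add: valency_def power2_eq_square sum_product adj_commute[of _ "_"])
  also have "\<dots> = (\<Sum>x\<in>P. \<Sum>y\<in>P. codeg x y)"
    unfolding codeg_def by (rule sum_rotate[symmetric])
  also have "\<dots> \<le> (\<Sum>x\<in>P. \<Sum>y\<in>P. (codeg x y)\<^sup>2 / cbrt + cbrt)"
    using t by (intro sum_mono le_square_div) auto
  also have "\<dots> = (\<Sum>x\<in>P. \<Sum>y\<in>P. (codeg x y)\<^sup>2) / cbrt + N\<^sup>2 * cbrt"
    by (simp add: sum.distrib sum_divide_distrib power2_eq_square)
  also have "\<dots> \<le> 74 * cbrt ^ 8 / cbrt + N\<^sup>2 * cbrt"
    using t by (intro add_right_mono divide_right_mono sum_codeg_square_le) auto
  also have "\<dots> = 75 * cbrt ^ 7"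
    using t by (simp add: cbrt_cube[symmetric] eval_nat_numeral)
  finally show ?thesis .
qed

text \<open>This is the Kovari-Sos-Turan exponent 5/3 for K_{3,3}, with the threshold at the typical
  degree \<open>cbrt\<^sup>2\<close>.\<close>

lemma sum_valency_le: "(\<Sum>x\<in>P. valency x) \<le> 76 * cbrt ^ 5"
proof -
  have t: "1 \<le> cbrt" by (rule cbrt_ge_1)
  have "(\<Sum>x\<in>P. valency x) \<le> (\<Sum>x\<in>P. (valency x)\<^sup>2 / cbrt\<^sup>2 + cbrt\<^sup>2)"
    using t by (intro sum_mono le_square_div) auto
  also have "\<dots> = (\<Sum>x\<in>P. (valency x)\<^sup>2) / cbrt\<^sup>2 + N * cbrt\<^sup>2"
    by (simp add: sum.distrib sum_divide_distrib)
  also have "\<dots> \<le> 75 * cbrt ^ 7 / cbrt\<^sup>2 + N * cbrt\<^sup>2"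
    using t by (intro add_right_mono divide_right_mono sum_valency_square_le) auto
  also have "\<dots> = 76 * cbrt ^ 5"
    using t by (simp add: cbrt_cube[symmetric] eval_nat_numeral)
  finally show ?thesis .
qed

text \<open>Counting inside neighbourhoods: the left side counts \<open>x\<close> with neighbours
  \<open>y\<close>, \<open>p\<close>, \<open>q\<close> such that \<open>y\<close> is adjacent to
  \<open>p\<close> and \<open>q\<close>. For distinct \<open>p\<close>, \<open>q\<close> the vertex
  \<open>y\<close> is a common neighbour of three distinct vertices, so the pair \<open>p\<close>,
  \<open>q\<close> determines it up to two choices; \<open>p = q\<close> leaves triangles.\<close>

lemma sum_adj_codeg_square_le:
  "(\<Sum>x\<in>P. \<Sum>y\<in>P. adj x y * (codeg x y)\<^sup>2)
    \<le> 2 * (\<Sum>x\<in>P. (valency x)\<^sup>2) + (\<Sum>x\<in>P. \<Sum>y\<in>P. adj x y * codeg x y)"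
proof -
  define h where "h p q r = (\<Sum>x\<in>P. adj p x * adj q x * adj r x)" for p q r
  have "(\<Sum>x\<in>P. \<Sum>y\<in>P. adj x y * (codeg x y)\<^sup>2) =
      (\<Sum>x\<in>P. \<Sum>y\<in>P. \<Sum>p\<in>P. \<Sum>q\<in>P. adj x p * adj x q * (adj x y * adj p y * adj q y))"
    by (simp add: codeg_def power2_eq_square sum_product sum_distrib_left sum_distrib_right mult_ac
        adj_commute[of _ "_"])
  also have "\<dots> = (\<Sum>x\<in>P. \<Sum>p\<in>P. \<Sum>q\<in>P. adj x p * adj x q * h x p q)"
    unfolding h_def sum_distrib_left by (intro sum.cong refl sum_rotate[symmetric])
  also have "\<dots> \<le> (\<Sum>x\<in>P. \<Sum>p\<in>P. \<Sum>q\<in>P. 2 * (adj x p * adj x q)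
      + of_bool (p = q) * (adj x p * codeg x p))"
  proof (intro sum_mono)
    fix x p q assume P: "x \<in> P" "p \<in> P" "q \<in> P"
    \<comment> \<open>Without loops, \<open>x = p\<close> or \<open>x = q\<close> makes the weight
      vanish, so the last case really has three distinct vertices.\<close>
    consider "p = q" | "p \<noteq> q" "adj x p * adj x q = 0" | "p \<noteq> q" "x \<noteq> p" "x \<noteq> q"
      using A_irrefl by (auto simp: adj_def)
    then show "adj x p * adj x q * h x p q
      \<le> 2 * (adj x p * adj x q) + of_bool (p = q) * (adj x p * codeg x p)"
    proof cases
      case 3
      then have "h x p q \<le> 2" using triple_le_2 P by (simp add: h_def)
      then have "adj x p * adj x q * h x p q \<le> adj x p * adj x q * 2"
        by (intro mult_left_mono) auto
      then show ?thesis using 3 by simp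
    qed (auto simp: h_def codeg_def mult_ac)
  qed
  also have "\<dots> = 2 * (\<Sum>x\<in>P. (valency x)\<^sup>2) + (\<Sum>x\<in>P. \<Sum>y\<in>P. adj x y * codeg x y)"
    by (simp add: sum.distrib valency_def power2_eq_square sum_product)
      (simp add: sum_distrib_left)
  finally show ?thesis .
qed

text \<open>Self-improvement again: with threshold \<open>2 * cbrt\<close> the triangle sum returns
  with coefficient at most 1/2. The constant is 2 (75 + 152).\<close>

lemma sum_triangles_le: "(\<Sum>x\<in>P. \<Sum>y\<in>P. adj x y * codeg x y) \<le> 454 * cbrt ^ 6"
proof -
  let ?T = "\<Sum>x\<in>P. \<Sum>y\<in>P. adj x y * codeg x y"
  have t: "1 \<le> cbrt" by (rule cbrt_ge_1)
  have T0: "0 \<le> ?T" by (intro sum_nonneg) auto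
  have "?T \<le> (\<Sum>x\<in>P. \<Sum>y\<in>P. adj x y * ((codeg x y)\<^sup>2 / (2 * cbrt) + 2 * cbrt))"
    using t by (intro sum_mono mult_left_mono le_square_div) auto
  also have "\<dots> = (\<Sum>x\<in>P. \<Sum>y\<in>P. adj x y * (codeg x y)\<^sup>2) / (2 * cbrt)
      + (\<Sum>x\<in>P. valency x) * (2 * cbrt)"
    by (simp add: valency_def distrib_left sum.distrib sum_divide_distrib sum_distrib_right)
  also have "\<dots> \<le> (2 * (75 * cbrt ^ 7) + ?T) / (2 * cbrt) + 76 * cbrt ^ 5 * (2 * cbrt)"
    using t sum_adj_codeg_square_le sum_valency_square_le
    by (intro add_mono divide_right_mono mult_right_mono sum_valency_le) auto
  also have "\<dots> = 75 * cbrt ^ 6 + ?T / (2 * cbrt) + 152 * cbrt ^ 6"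
    using t by (simp add: add_divide_distrib eval_nat_numeral)
  also have "?T / (2 * cbrt) \<le> ?T / 2"
    using t T0 by (intro divide_left_mono) auto
  finally show ?thesis by simp
qed

text \<open>The factor 8 serves both bounds below: its fourth power exceeds 74 and its cube, 512,
  exceeds 454.\<close>

definition lam :: real where "lam = 8 * cbrt\<^sup>2"

lemma lam_pos: "0 < lam"
  using cbrt_ge_1 by (simp add: lam_def)

lemma codeg_bound: "(\<Sum>x\<in>P. \<Sum>y\<in>P. (codeg x y)\<^sup>2) \<le> lam ^ 4"
proof -
  have "lam ^ 4 = 4096 * cbrt ^ 8" by (simp add: lam_def power_mult_distrib)
  then show ?thesis using sum_codeg_square_le cbrt_ge_1 by (smt (verit) zero_le_power)
qed

lemma triangle_bound: "(\<Sum>x\<in>P. \<Sum>y\<in>P. adj x y * codeg x y) \<le> lam ^ 3"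
proof -
  have "lam ^ 3 = 512 * cbrt ^ 6" by (simp add: lam_def power_mult_distrib)
  then show ?thesis using sum_triangles_le cbrt_ge_1 by (smt (verit) zero_le_power)
qed

text \<open>The left side is the quadratic form of the squared adjacency matrix \<open>codeg\<close>
  at \<open>f\<close>. By Cauchy-Schwarz over pairs it is at most the squared norm of
  \<open>f\<close> times the Hilbert-Schmidt norm of \<open>codeg\<close>, which
  \<open>codeg_bound\<close> puts below \<open>lam\<^sup>2\<close>.\<close>

lemma adj_operator_norm:
  "(\<Sum>x\<in>P. (\<Sum>y\<in>P. adj x y * f y)\<^sup>2) \<le> lam\<^sup>2 * (\<Sum>y\<in>P. (f y)\<^sup>2)"
proof -
  have "(\<Sum>x\<in>P. (\<Sum>y\<in>P. adj x y * f y)\<^sup>2)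
      = (\<Sum>x\<in>P. \<Sum>y\<in>P. \<Sum>z\<in>P. f y * f z * (adj y x * adj z x))"
    by (simp add: power2_eq_square sum_product mult_ac adj_commute[of _ "_"])
  also have "\<dots> = (\<Sum>y\<in>P. \<Sum>z\<in>P. f y * f z * codeg y z)"
    unfolding codeg_def sum_distrib_left by (rule sum_rotate[symmetric])
  also have "\<dots> = (\<Sum>(y, z)\<in>P \<times> P. (f y * f z) * codeg y z)"
    by (rule sum.cartesian_product)
  also have "\<dots> \<le> sqrt ((\<Sum>(y, z)\<in>P \<times> P. (f y * f z)\<^sup>2) * (\<Sum>(y, z)\<in>P \<times> P. (codeg y z)\<^sup>2))"
    using Cauchy_Schwarz_ineq_sum[of "\<lambda>(y, z). f y * f z" "\<lambda>(y, z). codeg y z" "P \<times> P"]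
    by (intro real_le_rsqrt) (simp add: case_prod_unfold)
  also have "(\<Sum>(y, z)\<in>P \<times> P. (f y * f z)\<^sup>2) = (\<Sum>y\<in>P. (f y)\<^sup>2)\<^sup>2"
    by (simp add: sum.cartesian_product[symmetric] power2_eq_square[of "sum _ _"] sum_product
        power_mult_distrib)
  also have "sqrt ((\<Sum>y\<in>P. (f y)\<^sup>2)\<^sup>2 * (\<Sum>(y, z)\<in>P \<times> P. (codeg y z)\<^sup>2))
      \<le> sqrt ((\<Sum>y\<in>P. (f y)\<^sup>2)\<^sup>2 * lam ^ 4)"
    using codeg_bound by (intro real_sqrt_le_mono mult_left_mono)
      (simp_all add: sum.cartesian_product[symmetric])
  also have "\<dots> = lam\<^sup>2 * (\<Sum>y\<in>P. (f y)\<^sup>2)"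
  proof -
    have "lam ^ 4 = (lam\<^sup>2)\<^sup>2" by simp
    then show ?thesis by (simp only: real_sqrt_mult real_sqrt_abs) (simp add: sum_nonneg)
  qed
  finally show ?thesis .
qed

end

section \<open>Weighted homomorphism counts and the removal of one pattern vertex\<close>

locale pattern_host = host_graph P A for P :: "'b set" and A +
  fixes E :: "'a \<Rightarrow> 'a \<Rightarrow> bool"
  assumes E_sym: "E u v \<Longrightarrow> E v u"
    and E_irrefl: "\<not> E v v"
begin

lemma A_commute: "A x y \<longleftrightarrow> A y x" and E_commute: "E u v \<longleftrightarrow> E v u"
  using A_sym E_sym by blast+

definition deg :: "'a set \<Rightarrow> 'a \<Rightarrow> nat" where
  "deg X v = card {u \<in> X. E v u}"

definition homs :: "'a set \<Rightarrow> ('a \<Rightarrow> 'b) set" where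
  "homs X = {\<phi> \<in> X \<rightarrow>\<^sub>E P. \<forall>u\<in>X. \<forall>v\<in>X. E u v \<longrightarrow> A (\<phi> u) (\<phi> v)}"

definition weighted_homs :: "'a set \<Rightarrow> ('a \<Rightarrow> 'b \<Rightarrow> real) \<Rightarrow> real" where
  "weighted_homs X w = (\<Sum>\<phi>\<in>homs X. \<Prod>v\<in>X. w v (\<phi> v))"

lemma finite_homs [simp]: "finite X \<Longrightarrow> finite (homs X)"
  unfolding homs_def by (rule finite_subset[of _ "X \<rightarrow>\<^sub>E P"]) (auto intro: finite_PiE)

lemma homs_in: "\<phi> \<in> homs X \<Longrightarrow> v \<in> X \<Longrightarrow> \<phi> v \<in> P"
  by (auto simp: homs_def)

lemma deg_remove:
  assumes "finite X" "s \<in> X" "v \<noteq> s"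
  shows "deg X v = deg (X - {s}) v + of_bool (E v s)"
proof -
  have "{u \<in> X. E v u} = (if E v s then insert s else id) {u \<in> X - {s}. E v u}"
    using assms by auto
  then show ?thesis using assms by (auto simp: deg_def)
qed

lemma sum_deg_remove:
  assumes "finite X" "s \<in> X"
  shows "(\<Sum>v\<in>X. deg X v) = (\<Sum>v\<in>X - {s}. deg (X - {s}) v) + 2 * deg X s"
proof -
  have "(\<Sum>v\<in>X. deg X v) = deg X s + (\<Sum>v\<in>X - {s}. deg X v)"
    using assms by (simp add: sum.remove)
  also have "(\<Sum>v\<in>X - {s}. deg X v) = (\<Sum>v\<in>X - {s}. deg (X - {s}) v) + (\<Sum>v\<in>X - {s}. of_bool (E v s))"
    using assms by (subst sum.distrib[symmetric]) (intro sum.cong refl deg_remove, auto)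
  also have "(\<Sum>v\<in>X - {s}. of_bool (E v s)) = deg X s"
  proof -
    have "{v \<in> X - {s}. E v s} = {u \<in> X. E s u}" using E_sym E_irrefl by auto
    then show ?thesis using assms by (simp add: deg_def flip: sum.inter_filter) (simp add: of_bool_def sum.If_cases Int_def)
  qed
  finally show ?thesis by simp
qed

lemma homs_insert_bij:
  assumes "s \<notin> X"
  shows "bij_betw (\<lambda>(p, \<phi>). \<phi>(s := p))
    {(p, \<phi>). p \<in> P \<and> \<phi> \<in> homs X \<and> (\<forall>u\<in>X. E s u \<longrightarrow> A p (\<phi> u))} (homs (insert s X))"
proof (rule bij_betw_byWitness[where f' = "\<lambda>\<phi>. (\<phi> s, restrict \<phi> X)"])
  show "\<forall>a\<in>{(p, \<phi>). p \<in> P \<and> \<phi> \<in> homs X \<and> (\<forall>u\<in>X. E s u \<longrightarrow> A p (\<phi> u))}.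
      ((case a of (p, \<phi>) \<Rightarrow> \<phi>(s := p)) s, restrict (case a of (p, \<phi>) \<Rightarrow> \<phi>(s := p)) X) = a"
    using assms by (auto simp: homs_def restrict_def PiE_def extensional_def fun_eq_iff)
  show "\<forall>\<phi>\<in>homs (insert s X). (case (\<phi> s, restrict \<phi> X) of (p, \<phi>) \<Rightarrow> \<phi>(s := p)) = \<phi>"
    by (auto simp: homs_def PiE_def extensional_def fun_eq_iff)
  show "(\<lambda>(p, \<phi>). \<phi>(s := p)) ` {(p, \<phi>). p \<in> P \<and> \<phi> \<in> homs X \<and> (\<forall>u\<in>X. E s u \<longrightarrow> A p (\<phi> u))}
      \<subseteq> homs (insert s X)"
    using assms E_irrefl by (auto simp: homs_def PiE_def extensional_def Pi_def A_commute E_commute)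
  show "(\<lambda>\<phi>. (\<phi> s, restrict \<phi> X)) ` homs (insert s X)
      \<subseteq> {(p, \<phi>). p \<in> P \<and> \<phi> \<in> homs X \<and> (\<forall>u\<in>X. E s u \<longrightarrow> A p (\<phi> u))}"
    by (auto simp: homs_def PiE_def Pi_def)
qed

lemma sum_homs_insert:
  assumes "finite X" "s \<notin> X"
  shows "(\<Sum>\<phi>\<in>homs (insert s X). F \<phi>) =
    (\<Sum>p\<in>P. \<Sum>\<phi>\<in>homs X. of_bool (\<forall>u\<in>X. E s u \<longrightarrow> A p (\<phi> u)) * (F (\<phi>(s := p)) :: real))"
proof -
  have "(\<Sum>\<phi>\<in>homs (insert s X). F \<phi>) = (\<Sum>(p, \<phi>) | p \<in> P \<and> \<phi> \<in> homs X \<and>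
      (\<forall>u\<in>X. E s u \<longrightarrow> A p (\<phi> u)). F (\<phi>(s := p)))"
    using sum.reindex_bij_betw[OF homs_insert_bij[OF assms(2)], of F, symmetric]
    by (simp add: case_prod_unfold)
  also have "\<dots> = (\<Sum>(p, \<phi>)\<in>P \<times> homs X.
      of_bool (\<forall>u\<in>X. E s u \<longrightarrow> A p (\<phi> u)) * F (\<phi>(s := p)))"
    using assms by (intro sum.mono_neutral_cong_left) auto
  also have "\<dots> = (\<Sum>p\<in>P. \<Sum>\<phi>\<in>homs X. of_bool (\<forall>u\<in>X. E s u \<longrightarrow> A p (\<phi> u)) * F (\<phi>(s := p)))"
    by (simp add: sum.cartesian_product)
  finally show ?thesis .
qed

lemma weighted_homs_remove:
  assumes "finite X" "s \<in> X"
  shows "weighted_homs X w = (\<Sum>p\<in>P. \<Sum>\<phi>\<in>homs (X - {s}).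
    of_bool (\<forall>u\<in>X - {s}. E s u \<longrightarrow> A p (\<phi> u)) * (w s p * (\<Prod>v\<in>X - {s}. w v (\<phi> v))))"
proof -
  have X: "X = insert s (X - {s})" using assms by auto
  have "weighted_homs X w = (\<Sum>\<phi>\<in>homs (insert s (X - {s})). \<Prod>v\<in>X. w v (\<phi> v))"
    using X by (simp add: weighted_homs_def)
  also have "\<dots> = (\<Sum>p\<in>P. \<Sum>\<phi>\<in>homs (X - {s}).
    of_bool (\<forall>u\<in>X - {s}. E s u \<longrightarrow> A p (\<phi> u)) * (\<Prod>v\<in>X. w v ((\<phi>(s := p)) v)))"
    using assms by (intro sum_homs_insert) auto
  also have "(\<lambda>p \<phi>. \<Prod>v\<in>X. w v ((\<phi>(s := p)) v)) = (\<lambda>p \<phi>. w s p * (\<Prod>v\<in>X - {s}. w v (\<phi> v)))"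
    using assms by (intro ext, subst prod.remove[of X s]) auto
  finally show ?thesis .
qed

lemma weighted_homs_cong:
  "(\<And>v. v \<in> X \<Longrightarrow> w v = w' v) \<Longrightarrow> weighted_homs X w = weighted_homs X w'"
  by (simp add: weighted_homs_def)

text \<open>Once the image \<open>p\<close> of \<open>s\<close> is fixed, the edges at
  \<open>s\<close> constrain each neighbour separately, so they can be absorbed into the weights of
  the neighbours.\<close>

lemma weighted_homs_condition:
  assumes X: "finite X" "s \<in> X"
  shows "weighted_homs X w = (\<Sum>p\<in>P. w s p *
    weighted_homs (X - {s}) (\<lambda>v q. if E s v then w v q * adj p q else w v q))"
proof -
  have "(\<Prod>v\<in>X - {s}. if E s v then w v (\<phi> v) * adj p (\<phi> v) else w v (\<phi> v)) =
    of_bool (\<forall>u\<in>X - {s}. E s u \<longrightarrow> A p (\<phi> u)) * (\<Prod>v\<in>X - {s}. w v (\<phi> v))" for p \<phi>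
  proof (cases "\<forall>u\<in>X - {s}. E s u \<longrightarrow> A p (\<phi> u)")
    case True
    then have "(\<Prod>v\<in>X - {s}. if E s v then w v (\<phi> v) * adj p (\<phi> v) else w v (\<phi> v))
        = (\<Prod>v\<in>X - {s}. w v (\<phi> v))"
      by (intro prod.cong) (auto simp: adj_def)
    then show ?thesis using True by simp
  next
    case False
    then show ?thesis using X by (auto simp: adj_def intro!: bexI prod_zero)
  qed
  then show ?thesis
    unfolding weighted_homs_remove[OF assms]
    by (simp add: weighted_homs_def sum_distrib_left mult_ac)
qed

lemma weighted_homs_isolated:
  assumes X: "finite X" "s \<in> X" and s: "deg X s = 0"
  shows "weighted_homs X w = (\<Sum>p\<in>P. w s p) * weighted_homs (X - {s}) w"
proof -
  have "\<not> E s u" if "u \<in> X" for u using s X that by (auto simp: deg_def)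
  then have "weighted_homs (X - {s}) (\<lambda>v q. if E s v then w v q * adj p q else w v q)
      = weighted_homs (X - {s}) w" for p
    by (intro weighted_homs_cong) auto
  then show ?thesis unfolding weighted_homs_condition[OF X] by (simp add: sum_distrib_right)
qed

text \<open>Summing over the image of the leaf applies the adjacency operator to its weight,
  evaluated at the image of its only neighbour.\<close>

lemma weighted_homs_leaf:
  assumes X: "finite X" "s \<in> X" and u: "{v \<in> X. E s v} = {u}"
  shows "weighted_homs X w =
    weighted_homs (X - {s}) (w(u := \<lambda>p. w u p * (\<Sum>q\<in>P. adj p q * w s q)))"
proof -
  let ?g = "\<lambda>p. \<Sum>q\<in>P. adj p q * w s q"
  have uX: "u \<in> X - {s}" using u E_irrefl by auto
  have c: "(\<forall>v\<in>X - {s}. E s v \<longrightarrow> A p (\<phi> v)) \<longleftrightarrow> A p (\<phi> u)" for p \<phi>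
    using u uX by auto
  have "weighted_homs X w = (\<Sum>\<phi>\<in>homs (X - {s}). ?g (\<phi> u) * (\<Prod>v\<in>X - {s}. w v (\<phi> v)))"
    unfolding weighted_homs_remove[OF X] c

    by (subst sum.swap) (simp add: sum_distrib_left sum_distrib_right mult_ac adj_commute[of _ "_"] flip: adj_def)
  also have "\<dots> = weighted_homs (X - {s}) (w(u := \<lambda>p. w u p * ?g p))"
    unfolding weighted_homs_def
  proof (intro sum.cong refl)
    fix \<phi>
    show "?g (\<phi> u) * (\<Prod>v\<in>X - {s}. w v (\<phi> v)) =
      (\<Prod>v\<in>X - {s}. (w(u := \<lambda>p. w u p * ?g p)) v (\<phi> v))"
      using X uX by (simp add: prod.remove[of "X - {s}" u])
  qed
  finally show ?thesis .
qed

section \<open>Norms of the weights and the bound for patterns of maximum degree two\<close>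

text \<open>A vertex of degree $d \<le> 2$ has $2 - d$ free slots, each carrying an \<open>\<ell>\<^sup>2\<close> vector; accordingly
  its weight is measured in the \<open>\<ell>\<^sup>1\<close>, \<open>\<ell>\<^sup>2\<close> or supremum norm.\<close>
definition weight_bound :: "nat \<Rightarrow> ('b \<Rightarrow> real) \<Rightarrow> real \<Rightarrow> bool" where
  "weight_bound d f c \<longleftrightarrow>
    (if d = 0 then (\<Sum>p\<in>P. f p) \<le> c else if d = 1 then (\<Sum>p\<in>P. (f p)\<^sup>2) \<le> c\<^sup>2 else \<forall>p\<in>P. f p \<le> c)"

text \<open>A vertex that loses an edge gains a free slot, filled here by \<open>g\<close>: from sup
  norm to l2 pointwise, from l2 to l1 by Cauchy-Schwarz.\<close>

lemma weight_bound_mult: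
  assumes f: "weight_bound (Suc d) f c" "\<And>p. 0 \<le> f p" "0 \<le> c" "d \<le> 1"
    and g: "(\<Sum>p\<in>P. (g p)\<^sup>2) \<le> b\<^sup>2" "0 \<le> b"
  shows "weight_bound d (\<lambda>p. f p * g p) (c * b)"
proof (cases "d = 0")
  case True
  have "(\<Sum>p\<in>P. f p * g p)\<^sup>2 \<le> (\<Sum>p\<in>P. (f p)\<^sup>2) * (\<Sum>p\<in>P. (g p)\<^sup>2)"
    by (rule Cauchy_Schwarz_ineq_sum)
  also have "\<dots> \<le> c\<^sup>2 * b\<^sup>2"
    using f(1) g(1) True by (intro mult_mono) (simp_all add: weight_bound_def sum_nonneg)
  also have "\<dots> = (c * b)\<^sup>2" by (simp add: power_mult_distrib)
  finally have "(\<Sum>p\<in>P. f p * g p) \<le> c * b"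
    by (rule power2_le_imp_le) (rule mult_nonneg_nonneg[OF f(3) g(2)])
  then show ?thesis using True by (simp add: weight_bound_def)
next
  case False
  then have d: "d = 1" using f(4) by simp
  have fc: "f p \<le> c" if "p \<in> P" for p using f(1) d that by (simp add: weight_bound_def)
  have "(\<Sum>p\<in>P. (f p * g p)\<^sup>2) \<le> (\<Sum>p\<in>P. c\<^sup>2 * (g p)\<^sup>2)"
    unfolding power_mult_distrib
    by (intro sum_mono mult_right_mono power_mono fc f(2)) simp_all
  also have "\<dots> \<le> c\<^sup>2 * b\<^sup>2"
    unfolding sum_distrib_left[symmetric] using g(1) by (intro mult_left_mono) simp_all
  finally show ?thesis using d by (simp add: weight_bound_def power_mult_distrib)
qed

definition admissible :: "'a set \<Rightarrow> ('a \<Rightarrow> 'b \<Rightarrow> real) \<Rightarrow> ('a \<Rightarrow> real) \<Rightarrow> bool" where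
  "admissible X w c \<longleftrightarrow> finite X \<and> (\<forall>v p. 0 \<le> w v p) \<and> (\<forall>v. 0 \<le> c v) \<and>
    (\<forall>v\<in>X. deg X v \<le> 2 \<and> weight_bound (deg X v) (w v) (c v))"

text \<open>The degree sum is twice the number of edges, so the first factor is one
  \<open>lam\<close> per edge.\<close>

definition hom_bound :: "'a set \<Rightarrow> ('a \<Rightarrow> real) \<Rightarrow> real" where
  "hom_bound X c = sqrt lam ^ (\<Sum>v\<in>X. deg X v) * (\<Prod>v\<in>X. c v)"

lemma hom_bound_nonneg: "(\<And>v. 0 \<le> c v) \<Longrightarrow> 0 \<le> hom_bound X c"
  using lam_pos by (simp add: hom_bound_def prod_nonneg)

lemma hom_bound_remove:
  assumes "finite X" "s \<in> X"
  shows "hom_bound X c = lam ^ deg X s * c s * hom_bound (X - {s}) c"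
proof -
  have "sqrt lam ^ (2 * deg X s) = lam ^ deg X s"
    using lam_pos by (simp add: power_mult)
  then show ?thesis
    unfolding hom_bound_def sum_deg_remove[OF assms] prod.remove[OF assms]
    by (simp add: power_add mult_ac)
qed

lemma hom_bound_scale:
  assumes "finite X" "u \<in> X"
  shows "hom_bound X (c(u := c u * a)) = a * hom_bound X c"
  using assms by (simp add: hom_bound_def prod.remove[of X u])

text \<open>With the image \<open>p\<close> of a vertex fixed, summing over the image
  \<open>r\<close> of its neighbour leaves this weight on the next vertex, placed at
  \<open>q\<close>.\<close>

lemma sum_mult_adj_le:
  assumes "\<And>p. 0 \<le> f p" "\<And>p. p \<in> P \<Longrightarrow> f p \<le> b"
  shows "(\<Sum>r\<in>P. adj q r * (f r * adj p r)) \<le> b * codeg p q"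
  unfolding codeg_def sum_distrib_left
  using assms by (intro sum_mono) (auto simp: adj_def)

lemma admissible_isolated:
  assumes "admissible X w c" "s \<in> X" "deg X s = 0"
  shows "admissible (X - {s}) w c"
proof -
  have "deg X v = deg (X - {s}) v" if "v \<in> X - {s}" for v
  proof -
    have "\<not> E v s" using assms that by (auto simp: deg_def admissible_def E_commute)
    then show ?thesis using deg_remove[of X s v] assms that by (auto simp: admissible_def)
  qed
  then show ?thesis using assms by (auto simp: admissible_def)
qed

text \<open>The neighbour \<open>u\<close> loses one edge and receives the adjacency operator
  applied to \<open>w s\<close>, whose l2 norm is at most \<open>lam * c s\<close> by
  \<open>adj_operator_norm\<close>.\<close>

lemma admissible_leaf:
  assumes good: "admissible X w c" and s: "s \<in> X" "{v \<in> X. E s v} = {u}"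
  shows "admissible (X - {s}) (w(u := \<lambda>p. w u p * (\<Sum>q\<in>P. adj p q * w s q)))
    (c(u := c u * (lam * c s)))"
proof -
  have X: "finite X" and w: "\<And>v p. 0 \<le> w v p" and c: "\<And>v. 0 \<le> c v"
    and wb: "\<And>v. v \<in> X \<Longrightarrow> deg X v \<le> 2 \<and> weight_bound (deg X v) (w v) (c v)"
    using good by (auto simp: admissible_def)
  have deg: "deg X v = deg (X - {s}) v + of_bool (v = u)" if "v \<in> X - {s}" for v
  proof -
    have "E s v \<longleftrightarrow> v = u" using s(2) that by blast
    then have "E v s \<longleftrightarrow> v = u" by (simp only: E_commute[of v s])
    then show ?thesis using deg_remove[OF X s(1), of v] that by simp
  qed
  have "weight_bound 1 (w s) (c s)" using wb[OF s(1)] s(2) by (simp add: deg_def)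
  then have "(\<Sum>q\<in>P. (w s q)\<^sup>2) \<le> (c s)\<^sup>2" by (simp add: weight_bound_def)
  then have "lam\<^sup>2 * (\<Sum>q\<in>P. (w s q)\<^sup>2) \<le> lam\<^sup>2 * (c s)\<^sup>2" by (intro mult_left_mono) auto
  then have g: "(\<Sum>p\<in>P. (\<Sum>q\<in>P. adj p q * w s q)\<^sup>2) \<le> (lam * c s)\<^sup>2"
    using adj_operator_norm[of "w s"] by (simp add: power_mult_distrib)
  have u: "u \<in> X - {s}" using s E_irrefl by auto
  have "weight_bound (deg (X - {s}) u) (\<lambda>p. w u p * (\<Sum>q\<in>P. adj p q * w s q)) (c u * (lam * c s))"
    using wb[of u] deg[OF u] u w c lam_pos g by (intro weight_bound_mult) auto
  moreover have "deg (X - {s}) v \<le> 2" if "v \<in> X - {s}" for v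
    using deg[OF that] wb[of v] that by auto
  moreover have "weight_bound (deg (X - {s}) v) (w v) (c v)" if "v \<in> X - {s}" "v \<noteq> u" for v
    using deg[OF that(1)] wb[of v] that by auto
  ultimately show ?thesis
    using X w c lam_pos by (auto simp: admissible_def intro!: mult_nonneg_nonneg sum_nonneg)
qed

text \<open>When all degrees are 2, the triangle on \<open>s\<close>, \<open>u\<close>,
  \<open>t\<close> is a whole component. With \<open>s\<close> fixed, \<open>u\<close> is a leaf at
  \<open>t\<close>, and after its removal \<open>t\<close> is isolated; the count factors into a
  triangle sum and the count for the rest.\<close>

lemma weighted_homs_le_triangle:
  assumes good: "admissible X w c" and s: "s \<in> X" "{v \<in> X. E s v} = {u, t}" "u \<noteq> t" "E u t"
    and deg2: "\<And>v. v \<in> X \<Longrightarrow> deg X v = 2"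
    and IH: "\<And>Y w c. card Y < card X \<Longrightarrow> admissible Y w c \<Longrightarrow> weighted_homs Y w \<le> hom_bound Y c"
  shows "weighted_homs X w \<le> hom_bound X c"
proof -
  have X: "finite X" and w: "\<And>v p. 0 \<le> w v p" and c: "\<And>v. 0 \<le> c v"
    and wb: "\<And>v p. v \<in> X \<Longrightarrow> p \<in> P \<Longrightarrow> w v p \<le> c v"
    using good deg2 by (auto simp: admissible_def weight_bound_def)
  have uX: "u \<in> X" "t \<in> X" "s \<noteq> u" "s \<noteq> t" "E s u" "E s t" using s E_irrefl by auto
  have Nu: "{v \<in> X. E u v} = {s, t}"
    using deg2[OF uX(1)] uX s X by (intro card_subset_eq[symmetric]) (auto simp: deg_def E_commute)
  have Nt: "{v \<in> X. E t v} = {s, u}"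
    using deg2[OF uX(2)] uX s X by (intro card_subset_eq[symmetric]) (auto simp: deg_def E_commute)
  let ?Y = "X - {s} - {u} - {t}"
  have nadj: "\<not> E s v" "\<not> E u v" "\<not> E t v" "\<not> E v s" "\<not> E v u" "\<not> E v t" if "v \<in> ?Y" for v
    using that s(2) Nu Nt E_commute by auto
  have "deg ?Y v = 2" if "v \<in> ?Y" for v
  proof -
    have "{x \<in> ?Y. E v x} = {x \<in> X. E v x}" using nadj[OF that] by auto
    then show ?thesis using deg2[of v] that by (simp add: deg_def)
  qed
  then have "admissible ?Y w c" using X w c wb by (auto simp: admissible_def weight_bound_def)
  then have IHY: "weighted_homs ?Y w \<le> hom_bound ?Y c"
    using s X by (intro IH psubset_card_mono) auto
  have N1: "{v \<in> X - {s}. E u v} = {t}" and N2: "{v \<in> X - {s} - {u}. E t v} = {}"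
    using Nu Nt uX s(3) by auto
  let ?g = "\<lambda>p q. \<Sum>r\<in>P. adj q r * (w u r * adj p r)"
  have red: "weighted_homs (X - {s}) (\<lambda>v q. if E s v then w v q * adj p q else w v q)
      = (\<Sum>q\<in>P. w t q * adj p q * ?g p q) * weighted_homs ?Y w" for p
    using X uX s(3) N1 N2 nadj
    by (subst weighted_homs_leaf[where s = u and u = t])
      (auto simp: weighted_homs_isolated[where s = t] deg_def intro!: weighted_homs_cong)
  have "weighted_homs X w = (\<Sum>p\<in>P. w s p * (\<Sum>q\<in>P. w t q * adj p q * ?g p q)) * weighted_homs ?Y w"
    unfolding weighted_homs_condition[OF X s(1)] red by (simp add: sum_distrib_left sum_distrib_right mult_ac)
  also have "\<dots> \<le> (\<Sum>p\<in>P. w s p * (\<Sum>q\<in>P. w t q * adj p q * ?g p q)) * hom_bound ?Y c"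
    using IHY w by (intro mult_left_mono sum_nonneg mult_nonneg_nonneg) auto
  also have "\<dots> \<le> (\<Sum>p\<in>P. c s * (\<Sum>q\<in>P. c t * adj p q * (c u * codeg p q))) * hom_bound ?Y c"
    using w c wb uX s by (intro mult_right_mono sum_mono mult_mono sum_mult_adj_le hom_bound_nonneg sum_nonneg mult_nonneg_nonneg) auto
  also have "\<dots> = (\<Sum>p\<in>P. \<Sum>q\<in>P. adj p q * codeg p q) * (c s * c t * c u * hom_bound ?Y c)"
    by (simp add: sum_distrib_left sum_distrib_right mult_ac)
  also have "\<dots> \<le> lam ^ 3 * (c s * c t * c u * hom_bound ?Y c)"
    using c by (intro mult_right_mono triangle_bound mult_nonneg_nonneg hom_bound_nonneg) auto
  also have "\<dots> = hom_bound X c"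
  proof -
    \<comment> \<open>The degrees at removal are 2, 1 and 0, matching the three powers of
      \<open>lam\<close> from the triangle bound.\<close>
    have "deg (X - {s}) u = 1" "deg (X - {s} - {u}) t = 0"
      unfolding deg_def N1 N2 by simp_all
    then show ?thesis
      using X uX s(1,3) deg2[of s]
      by (simp add: hom_bound_remove[of X s] hom_bound_remove[of "X - {s}" u]
        hom_bound_remove[of "X - {s} - {u}" t] eval_nat_numeral)
  qed
  finally show ?thesis .
qed

text \<open>Since \<open>u\<close> and \<open>t\<close> are not adjacent, removing \<open>s\<close>,
  \<open>u\<close>, \<open>t\<close> destroys four edges. For fixed image \<open>p\<close> of
  \<open>s\<close>, the next vertices \<open>u'\<close> and \<open>t'\<close> each receive a weight
  dominated by a multiple of the codegrees with \<open>p\<close>; the product of the two norms,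
  summed over \<open>p\<close>, is the second codegree moment, at most
  \<open>lam ^ 4\<close>.\<close>

lemma weighted_homs_le_long_cycle:
  assumes good: "admissible X w c" and s: "s \<in> X" "{v \<in> X. E s v} = {u, t}" "u \<noteq> t" "\<not> E u t"
    and deg2: "\<And>v. v \<in> X \<Longrightarrow> deg X v = 2"
    and IH: "\<And>Y w c. card Y < card X \<Longrightarrow> admissible Y w c \<Longrightarrow> weighted_homs Y w \<le> hom_bound Y c"
  shows "weighted_homs X w \<le> hom_bound X c"
proof -
  have X: "finite X" and w: "\<And>v p. 0 \<le> w v p" and c: "\<And>v. 0 \<le> c v"
    and wb: "\<And>v p. v \<in> X \<Longrightarrow> p \<in> P \<Longrightarrow> w v p \<le> c v"
    using good deg2 by (auto simp: admissible_def weight_bound_def)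
  have uX: "u \<in> X" "t \<in> X" "s \<noteq> u" "s \<noteq> t" "E s u" "E s t" "E u s" "E t s" "\<not> E t u" "\<not> E u u" "\<not> E t t"
    using s E_irrefl E_sym by auto
  have other: "\<exists>y. {v \<in> X. E x v} = {s, y} \<and> y \<noteq> s" if "x \<in> X" "E x s" for x
  proof -
    have "card {v \<in> X. E x v} = 2" using deg2[OF that(1)] by (simp add: deg_def)
    then obtain a b where ab: "{v \<in> X. E x v} = {a, b}" "a \<noteq> b" by (auto simp: card_2_iff)
    then have "s \<in> {a, b}" using that s(1) by blast
    then show ?thesis using ab by (metis empty_iff insert_commute insert_iff)
  qed
  obtain u' where u': "{v \<in> X. E u v} = {s, u'}" "u' \<noteq> s" using other[of u] uX by auto
  obtain t' where t': "{v \<in> X. E t v} = {s, t'}" "t' \<noteq> s" using other[of t] uX by auto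
  let ?Y = "X - {s} - {u} - {t}"
  have u'Y: "u' \<in> ?Y" "t' \<in> ?Y" using u' t' s(4) uX by auto
  have nadj: "\<not> E s v" "\<not> E v s" "E v u \<longleftrightarrow> v = u'" "E v t \<longleftrightarrow> v = t'" if "v \<in> ?Y" for v
    using that s(2) u' t' E_commute by auto
  \<comment> \<open>In a cycle of length four \<open>u' = t'\<close>, and this vertex loses two
    edges; hence separate indicators.\<close>
  have degY: "deg ?Y v + of_bool (v = u') + of_bool (v = t') = 2" if "v \<in> ?Y" for v
    using deg_remove[of X s v] deg_remove[of "X - {s}" u v] deg_remove[of "X - {s} - {u}" t v]
      nadj[OF that] that X uX s deg2[of v] by simp
  have N1: "{v \<in> X - {s}. E u v} = {u'}" and N2: "{v \<in> X - {s} - {u}. E t v} = {t'}"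
    using u' t' uX u'Y by auto
  define g where "g x p q = (\<Sum>r\<in>P. adj q r * (w x r * adj p r))" for x p q
  have g0: "0 \<le> g x p q" for x p q using w by (simp add: g_def sum_nonneg)
  define \<kappa> where "\<kappa> p = sqrt (\<Sum>q\<in>P. (codeg p q)\<^sup>2)" for p
  have \<kappa>0: "0 \<le> \<kappa> p" and \<kappa>2: "\<kappa> p * \<kappa> p = (\<Sum>q\<in>P. (codeg p q)\<^sup>2)" for p
    by (simp_all add: \<kappa>_def sum_nonneg)
  have g_norm: "(\<Sum>q\<in>P. (g x p q)\<^sup>2) \<le> (c x * \<kappa> p)\<^sup>2" if "x \<in> X" for x p
  proof -
    have "(\<Sum>q\<in>P. (g x p q)\<^sup>2) \<le> (\<Sum>q\<in>P. (c x * codeg p q)\<^sup>2)"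
      using g0 that w wb by (intro sum_mono power_mono) (auto simp: g_def intro!: sum_mult_adj_le)
    also have "\<dots> = (c x * \<kappa> p)\<^sup>2"
      by (simp add: power_mult_distrib power2_eq_square[of "\<kappa> p"] \<kappa>2 sum_distrib_left)
    finally show ?thesis .
  qed
  \<comment> \<open>The updates are made one after the other, so that both factors accumulate on one
    vertex when \<open>u' = t'\<close>.\<close>
  define w1 where "w1 p = w(u' := \<lambda>q. w u' q * g u p q)" for p
  define w2 where "w2 p = (w1 p)(t' := \<lambda>q. w1 p t' q * g t p q)" for p
  define c1 where "c1 p = c(u' := c u' * (c u * \<kappa> p))" for p
  define c2 where "c2 p = (c1 p)(t' := c1 p t' * (c t * \<kappa> p))" for p
  have w1: "0 \<le> w1 p v q" and w2: "0 \<le> w2 p v q" and c1: "0 \<le> c1 p v" and c2: "0 \<le> c2 p v" for p v q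
    using w c g0 \<kappa>0 by (auto simp: w1_def w2_def c1_def c2_def)
  \<comment> \<open>The index is the degree of \<open>v\<close> at the intermediate stage, with
    \<open>s\<close> and \<open>u\<close> removed but \<open>t\<close> still present.\<close>
  have "weight_bound (2 - of_bool (v = u')) (w1 p v) (c1 p v)" if "v \<in> ?Y" for p v
  proof (cases "v = u'")
    case True
    have "weight_bound (Suc 1) (w u') (c u')" using wb that True by (simp add: weight_bound_def)
    then show ?thesis
      using True w c \<kappa>0 g_norm uX weight_bound_mult[of 1 "w u'" "c u'" "g u p" "c u * \<kappa> p"]
      by (simp add: w1_def c1_def)
  qed (use wb that in \<open>auto simp: w1_def c1_def weight_bound_def\<close>)
  then have wb1: "weight_bound (2 - of_bool (v = u')) (w1 p v) (c1 p v)" if "v \<in> ?Y" for p v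
    using that by blast
  have wb2: "weight_bound (deg ?Y v) (w2 p v) (c2 p v)" if "v \<in> ?Y" for p v
  proof (cases "v = t'")
    case True
    have "2 - of_bool (v = u') = Suc (deg ?Y v)" "deg ?Y v \<le> 1" using degY[OF that] True by (auto split: if_splits)
    then show ?thesis
      using True wb1[OF that, of p] w1 c1 \<kappa>0 g_norm uX c
        weight_bound_mult[of "deg ?Y v" "w1 p v" "c1 p v" "g t p" "c t * \<kappa> p"]
      by (simp add: w2_def c2_def)
  next
    case False
    then have "2 - of_bool (v = u') = deg ?Y v" using degY[OF that] by auto
    then show ?thesis using False wb1[OF that, of p] by (simp add: w2_def c2_def)
  qed
  have "deg ?Y v \<le> 2" if "v \<in> ?Y" for v using degY[OF that] by linarith
  then have "admissible ?Y (w2 p) (c2 p)" for p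
    using X w2 c2 wb2 by (auto simp: admissible_def)
  then have IHY: "weighted_homs ?Y (w2 p) \<le> hom_bound ?Y (c2 p)" for p
    using s X by (intro IH psubset_card_mono) auto
  have red: "weighted_homs (X - {s}) (\<lambda>v q. if E s v then w v q * adj p q else w v q)
      = weighted_homs ?Y (w2 p)" for p
  proof -
    let ?w = "\<lambda>v q. if E s v then w v q * adj p q else w v q"
    let ?w1 = "?w(u' := \<lambda>q. ?w u' q * (\<Sum>r\<in>P. adj q r * ?w u r))"
    have ut: "u' \<noteq> t" "t' \<noteq> u" using u'Y by auto
    have "weighted_homs (X - {s}) ?w = weighted_homs (X - {s} - {u}) ?w1"
      using X uX N1 by (intro weighted_homs_leaf) auto
    also have "\<dots> = weighted_homs ?Y (?w1(t' := \<lambda>q. ?w1 t' q * (\<Sum>r\<in>P. adj q r * ?w1 t r)))"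
      using X uX s N2 by (intro weighted_homs_leaf) auto
    also have "\<dots> = weighted_homs ?Y (w2 p)"
      using nadj(1) u'Y uX ut by (intro weighted_homs_cong) (auto simp: w2_def w1_def g_def fun_eq_iff)
    finally show ?thesis .
  qed
  have finite_Y: "finite ?Y" using X by simp
  have hb: "hom_bound ?Y (c2 p) = \<kappa> p * \<kappa> p * (c u * c t * hom_bound ?Y c)" for p
    unfolding c2_def hom_bound_scale[OF finite_Y u'Y(2)] unfolding c1_def hom_bound_scale[OF finite_Y u'Y(1)]
    by (simp only: mult_ac)
  have "weighted_homs X w = (\<Sum>p\<in>P. w s p * weighted_homs ?Y (w2 p))"
    unfolding weighted_homs_condition[OF X s(1)] red ..
  also have "\<dots> \<le> (\<Sum>p\<in>P. c s * hom_bound ?Y (c2 p))"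
  proof (intro sum_mono)
    fix p assume "p \<in> P"
    have "w s p * weighted_homs ?Y (w2 p) \<le> w s p * hom_bound ?Y (c2 p)"
      using w IHY by (intro mult_left_mono)
    also have "\<dots> \<le> c s * hom_bound ?Y (c2 p)"
      using wb[OF s(1) \<open>p \<in> P\<close>] c2 by (intro mult_right_mono hom_bound_nonneg)
    finally show "w s p * weighted_homs ?Y (w2 p) \<le> c s * hom_bound ?Y (c2 p)" .
  qed
  also have "\<dots> = (\<Sum>p\<in>P. \<Sum>q\<in>P. (codeg p q)\<^sup>2) * (c s * c u * c t * hom_bound ?Y c)"
    unfolding hb \<kappa>2 by (simp add: sum_distrib_right mult_ac flip: sum_distrib_left)
  also have "\<dots> \<le> lam ^ 4 * (c s * c u * c t * hom_bound ?Y c)"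
    using c by (intro mult_right_mono codeg_bound mult_nonneg_nonneg hom_bound_nonneg) auto
  also have "\<dots> = hom_bound X c"
  proof -
    \<comment> \<open>Here the degrees at removal are 2, 1 and 1, matching
      \<open>lam ^ 4\<close>.\<close>
    have "deg (X - {s}) u = 1" "deg (X - {s} - {u}) t = 1"
      unfolding deg_def N1 N2 by simp_all
    then show ?thesis
      using X uX s(1,3) deg2[of s]
      by (simp add: hom_bound_remove[of X s] hom_bound_remove[of "X - {s}" u]
        hom_bound_remove[of "X - {s} - {u}" t] eval_nat_numeral)
  qed
  finally show ?thesis .
qed

text \<open>Every removal costs one \<open>lam\<close> per destroyed edge, exactly what
  \<open>hom_bound\<close> provides, so no constant accumulates in the induction.\<close>

theorem weighted_homs_le: "admissible X w c \<Longrightarrow> weighted_homs X w \<le> hom_bound X c"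
proof (induction "card X" arbitrary: X w c rule: less_induct)
  case less
  have X: "finite X" and w: "\<And>v p. 0 \<le> w v p" and c: "\<And>v. 0 \<le> c v"
    and wb: "\<And>v. v \<in> X \<Longrightarrow> deg X v \<le> 2 \<and> weight_bound (deg X v) (w v) (c v)"
    using less.prems by (auto simp: admissible_def)
  have smaller: "card (X - {s}) < card X" if "s \<in> X" for s
    using X that by (intro psubset_card_mono) auto
  consider "X = {}" | s where "s \<in> X" "deg X s = 0" | s where "s \<in> X" "deg X s = 1"
    | s where "s \<in> X" "\<And>v. v \<in> X \<Longrightarrow> deg X v = 2"
  proof (cases "X = {}")
    case False
    then obtain s where s: "s \<in> X" by blast
    have "deg X v = 0 \<or> deg X v = 1 \<or> deg X v = 2" if "v \<in> X" for v using wb[OF that] by linarith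
    then show ?thesis using that s by metis
  qed
  then show ?case
  proof cases
    case 1
    then show ?thesis by (simp add: weighted_homs_def homs_def hom_bound_def)
  next
    case (2 s)
    have "weighted_homs X w = (\<Sum>p\<in>P. w s p) * weighted_homs (X - {s}) w"
      using 2 X by (intro weighted_homs_isolated)
    also have "\<dots> \<le> c s * hom_bound (X - {s}) c"
      using less.hyps[OF smaller admissible_isolated[OF less.prems]] 2 c w wb[of s]
      by (intro mult_mono) (auto simp: weight_bound_def weighted_homs_def intro!: sum_nonneg prod_nonneg)
    also have "\<dots> = hom_bound X c" using 2 X by (simp add: hom_bound_remove[of X s])
    finally show ?thesis .
  next
    case (3 s)
    then obtain u where u: "{v \<in> X. E s v} = {u}" by (auto simp: deg_def card_1_singleton_iff)
    then have "u \<in> X - {s}" using E_irrefl by auto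
    have "weighted_homs X w = weighted_homs (X - {s}) (w(u := \<lambda>p. w u p * (\<Sum>q\<in>P. adj p q * w s q)))"
      using 3 X u by (intro weighted_homs_leaf)
    also have "\<dots> \<le> hom_bound (X - {s}) (c(u := c u * (lam * c s)))"
      using 3 u less.prems by (intro less.hyps smaller admissible_leaf)
    also have "\<dots> = hom_bound X c"
      using X 3 \<open>u \<in> X - {s}\<close> by (simp add: hom_bound_remove[of X s] hom_bound_scale)
    finally show ?thesis .
  next
    case (4 s)
    then obtain u t where ut: "{v \<in> X. E s v} = {u, t}" "u \<noteq> t"
      by (metis (no_types, lifting) card_2_iff deg_def)
    show ?thesis
      using weighted_homs_le_triangle[OF less.prems 4(1) ut _ 4(2)]
        weighted_homs_le_long_cycle[OF less.prems 4(1) ut _ 4(2)] less.hyps by blast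
  qed
qed

section \<open>Injective homomorphisms and vertices of degree three\<close>

definition inj_homs :: "'a set \<Rightarrow> ('a \<Rightarrow> 'b) set" where
  "inj_homs X = {\<phi> \<in> homs X. inj_on \<phi> X}"

lemma finite_inj_homs: "finite X \<Longrightarrow> finite (inj_homs X)"
  by (simp add: inj_homs_def)

text \<open>Injectivity keeps the images of the three neighbours of \<open>s\<close> distinct, so
  \<open>common_neighbours\<close> leaves at most two images for \<open>s\<close>.\<close>

lemma card_inj_homs_remove:
  assumes X: "finite X" "s \<in> X" and s: "deg X s = 3"
  shows "card (inj_homs X) \<le> 2 * card (inj_homs (X - {s}))"
proof -
  let ?Y = "X - {s}"
  let ?C = "\<lambda>\<psi>. {p \<in> P. \<forall>u\<in>?Y. E s u \<longrightarrow> A (\<psi> u) p}"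
  have "inj_homs X \<subseteq> (\<lambda>(\<psi>, p). \<psi>(s := p)) ` Sigma (inj_homs ?Y) ?C"
  proof
    fix \<phi> assume "\<phi> \<in> inj_homs X"
    then have \<phi>: "\<phi> \<in> X \<rightarrow>\<^sub>E P" "\<And>u v. u \<in> X \<Longrightarrow> v \<in> X \<Longrightarrow> E u v \<Longrightarrow> A (\<phi> u) (\<phi> v)" "inj_on \<phi> X"
      by (auto simp: inj_homs_def homs_def)
    have "restrict \<phi> ?Y \<in> inj_homs ?Y"
      using \<phi> by (auto simp: inj_homs_def homs_def inj_on_def)
    moreover have "\<phi> s \<in> ?C (restrict \<phi> ?Y)"
      using \<phi> X E_sym by auto
    moreover have "\<phi> = (restrict \<phi> ?Y)(s := \<phi> s)"
      using \<phi>(1) by (auto simp: fun_eq_iff PiE_def extensional_def)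
    ultimately show "\<phi> \<in> (\<lambda>(\<psi>, p). \<psi>(s := p)) ` Sigma (inj_homs ?Y) ?C"
      by (intro image_eqI[of _ _ "(restrict \<phi> ?Y, \<phi> s)"]) auto
  qed
  then have "card (inj_homs X) \<le> card (Sigma (inj_homs ?Y) ?C)"
    using X by (intro surj_card_le finite_SigmaI finite_inj_homs) auto
  also have "\<dots> = (\<Sum>\<psi>\<in>inj_homs ?Y. card (?C \<psi>))"
    using X by (simp add: finite_inj_homs)
  also have "\<dots> \<le> (\<Sum>\<psi>\<in>inj_homs ?Y. 2)"
  proof (intro sum_mono)
    fix \<psi> assume \<psi>: "\<psi> \<in> inj_homs ?Y"
    obtain a b c where abc: "{u \<in> X. E s u} = {a, b, c}" "a \<noteq> b" "a \<noteq> c" "b \<noteq> c"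
      using s by (auto simp: deg_def card_3_iff)
    then have Y: "a \<in> ?Y" "b \<in> ?Y" "c \<in> ?Y" "E s a" "E s b" "E s c" using E_irrefl by auto
    have "?C \<psi> \<subseteq> {p \<in> P. A (\<psi> a) p \<and> A (\<psi> b) p \<and> A (\<psi> c) p}" using Y by blast
    then have "card (?C \<psi>) \<le> card {p \<in> P. A (\<psi> a) p \<and> A (\<psi> b) p \<and> A (\<psi> c) p}"
      by (intro card_mono) auto
    also have "\<dots> \<le> 2"
    proof (rule common_neighbours)
      show "\<psi> a \<in> P" "\<psi> b \<in> P" "\<psi> c \<in> P" using \<psi> Y homs_in unfolding inj_homs_def by blast+
      have "inj_on \<psi> ?Y" using \<psi> by (simp add: inj_homs_def)
      then show "\<psi> a \<noteq> \<psi> b" "\<psi> a \<noteq> \<psi> c" "\<psi> b \<noteq> \<psi> c" using Y abc(2-4) by (metis inj_on_contraD)+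
    qed
    finally show "card (?C \<psi>) \<le> 2" .
  qed
  finally show ?thesis by simp
qed

text \<open>Apply the weighted bound to constant weights 1, whose norms are \<open>N\<close>,
  \<open>sqrt N\<close> and 1 in degrees 0, 1 and 2. With e edges, each \<open>lam\<close> of order
  \<open>N powr (2/3)\<close>, the exponent is k - e + 2e/3 = k - e/3, and e/3 is a sixth of the
  degree sum.\<close>

lemma card_homs_le:
  assumes X: "finite X" and deg: "\<And>v. v \<in> X \<Longrightarrow> deg X v \<le> 2"
  shows "real (card (homs X)) \<le> 8 ^ card X * N powr (real (card X) - real (\<Sum>v\<in>X. deg X v) / 6)"
proof -
  let ?d = "\<Sum>v\<in>X. deg X v" and ?c = "\<lambda>v. sqrt N ^ (2 - deg X v)"
  have d: "?d \<le> 2 * card X"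
    using sum_bounded_above[of X "deg X" 2] deg by (simp add: mult.commute)
  have powr_N: "(N powr a) ^ m = N powr (a * real m)" for a m
  proof -
    have "N \<noteq> 0" using N_ge_1 by linarith
    then show ?thesis by (subst powr_power) (simp_all add: mult.commute)
  qed
  have "weight_bound (deg X v) (\<lambda>_. 1) (?c v)" if "v \<in> X" for v
    using deg[OF that] N_ge_1 by (auto simp: weight_bound_def le_Suc_eq numeral_2_eq_2)
  then have "admissible X (\<lambda>_ _. 1) ?c"
    using X deg by (simp add: admissible_def)
  then have "weighted_homs X (\<lambda>_ _. 1) \<le> hom_bound X ?c"
    by (rule weighted_homs_le)
  also have "weighted_homs X (\<lambda>_ _. 1) = real (card (homs X))"
    by (simp add: weighted_homs_def)
  also have "hom_bound X ?c = sqrt lam ^ ?d * sqrt N ^ (2 * card X - ?d)"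
    using deg by (simp add: hom_bound_def flip: power_sum) (simp add: sum_subtractf_nat mult.commute)
  also have "sqrt lam = sqrt 8 * cbrt"
    using cbrt_ge_1 by (simp add: lam_def real_sqrt_mult)
  also have "(sqrt 8 * cbrt) ^ ?d * sqrt N ^ (2 * card X - ?d)
      = sqrt 8 ^ ?d * (cbrt ^ ?d * sqrt N ^ (2 * card X - ?d))"
    by (simp add: power_mult_distrib)
  also have "cbrt ^ ?d = N powr (real ?d / 3)"
    using powr_N[of "1/3"] by (simp add: cbrt_def del: of_nat_sum)
  also have "sqrt N ^ (2 * card X - ?d) = N powr ((2 * real (card X) - real ?d) / 2)"
    using powr_N[of "1/2"] d by (simp add: powr_half_sqrt of_nat_diff del: of_nat_sum)
  also have "N powr (real ?d / 3) * N powr ((2 * real (card X) - real ?d) / 2)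
      = N powr (real (card X) - real ?d / 6)"
    by (simp add: powr_add[symmetric] field_simps)
  \<comment> \<open>The degree sum is at most twice the number of vertices, which makes the constant
    depend on \<open>card X\<close> alone.\<close>
  also have "sqrt 8 ^ ?d * \<dots> \<le> sqrt 8 ^ (2 * card X) * \<dots>"
    using d by (intro mult_right_mono power_increasing) auto
  also have "sqrt 8 ^ (2 * card X) = (8::real) ^ card X"
    by (simp add: power_mult)
  finally show ?thesis .
qed

text \<open>Vertices of degree 3 are removed first, each at a factor 2, which is below the 8 allowed
  per vertex. Injectivity is given up only when none is left.\<close>

theorem card_inj_homs_le:
  assumes "finite X" and "\<And>v. v \<in> X \<Longrightarrow> deg X v \<le> 3"
  shows "real (card (inj_homs X))
    \<le> 8 ^ card X * N powr (real (card X) - real (\<Sum>v\<in>X. deg X v) / 6)"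
  using assms
proof (induction "card X" arbitrary: X rule: less_induct)
  case less
  show ?case
  proof (cases "\<exists>s\<in>X. deg X s = 3")
    case True
    then obtain s where s: "s \<in> X" "deg X s = 3" by blast
    let ?Y = "X - {s}"
    define m where "m = card ?Y"
    have m: "card X = Suc m"
      unfolding m_def using card_Suc_Diff1[OF less.prems(1) s(1)] by simp
    have "deg ?Y v \<le> 3" if "v \<in> ?Y" for v
    proof -
      have "deg X v \<le> 3" using less.prems(2) that by blast
      then show ?thesis using deg_remove[OF less.prems(1) s(1), of v] that by simp
    qed
    moreover have "card ?Y < card X" unfolding m m_def by simp
    ultimately have IH: "real (card (inj_homs ?Y))
        \<le> 8 ^ m * N powr (real m - real (\<Sum>v\<in>?Y. deg ?Y v) / 6)"
      unfolding m_def using less.prems(1) by (intro less.hyps) simp_all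
    \<comment> \<open>Removing \<open>s\<close> lowers the number of vertices by 1 and the degree
      sum by 6, so the exponent is unchanged.\<close>
    have e: "real (card X) - real (\<Sum>v\<in>X. deg X v) / 6 = real m - real (\<Sum>v\<in>?Y. deg ?Y v) / 6"
      unfolding sum_deg_remove[OF less.prems(1) s(1)] s(2) m by (simp add: add_divide_distrib)
    have "real (card (inj_homs X)) \<le> 2 * real (card (inj_homs ?Y))"
      using card_inj_homs_remove[OF less.prems(1) s] by linarith
    also have "\<dots> \<le> 8 * (8 ^ m * N powr (real m - real (\<Sum>v\<in>?Y. deg ?Y v) / 6))"
      using IH by linarith
    also have "\<dots> = 8 ^ card X * N powr (real (card X) - real (\<Sum>v\<in>X. deg X v) / 6)"
      unfolding e by (simp add: m)
    finally show ?thesis .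
  next
    case False
    have "deg X v \<le> 2" if "v \<in> X" for v
    proof -
      have "deg X v \<noteq> 3" using False that by blast
      then show ?thesis using less.prems(2)[OF that] by linarith
    qed
    then have "real (card (homs X)) \<le> 8 ^ card X * N powr (real (card X) - real (\<Sum>v\<in>X. deg X v) / 6)"
      using less.prems by (intro card_homs_le)
    moreover have "card (inj_homs X) \<le> card (homs X)"
      using less.prems by (intro card_mono) (auto simp: inj_homs_def)
    ultimately show ?thesis by linarith
  qed
qed

end

section \<open>Application to copies in unit distance graphs\<close>

text \<open>Each copy is the image of some injective homomorphism, namely an isomorphism onto it
  restricted to the vertices of \<open>G\<close>. The degree sum is 3k, which gives the exponent k -
  3k/6 = k/2.\<close>

lemma card_unit_distance_copies_le:
  fixes G :: "'a pair_pre_digraph" and P :: "(real ^ 3) set"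
  assumes G: "pair_graph G" "regular 3 G" "card (pverts G) = k"
    and P: "finite P" "P \<noteq> {}"
  shows "real (card (unit_distance_copies G P)) \<le> 8 ^ k * real (card P) powr (real k / 2)"
proof -
  interpret G: pair_graph G by fact
  interpret pattern_host P "\<lambda>x y. dist x y = 1" "\<lambda>u v. (u, v) \<in> parcs G"
  proof
    show "(v, u) \<in> parcs G" if "(u, v) \<in> parcs G" for u v
      using G.graph_symmetric that by simp
    show "(v, v) \<notin> parcs G" for v
      using G.no_loops by fastforce
  qed (use P card_common_unit_neighbours_le in \<open>auto simp: dist_commute\<close>)
  have deg: "deg (pverts G) v = 3" if "v \<in> pverts G" for v
  proof -
    have "{e \<in> parcs G. fst e = v} = Pair v ` {u \<in> pverts G. (v, u) \<in> parcs G}"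
      using G.in_arcsD2 by force
    then have "card {e \<in> parcs G. fst e = v} = deg (pverts G) v"
      by (simp add: deg_def card_image inj_on_def)
    then show ?thesis
      using G(2) that by (simp add: regular_def out_degree_def out_arcs_def)
  qed
  have "unit_distance_copies G P
    \<subseteq> (\<lambda>\<phi>. \<lparr>pverts = \<phi> ` pverts G, parcs = map_prod \<phi> \<phi> ` parcs G\<rparr>) ` inj_homs (pverts G)"
  proof
    fix H assume "H \<in> unit_distance_copies G P"
    then have sub: "pverts H \<subseteq> P" "parcs H \<subseteq> {(x, y). dist x y = 1}"
      and iso: "digraph_iso (with_proj G) (with_proj H)"
      by (auto simp: unit_distance_copies_def subgraph_def unit_distance_graph_def)
    obtain f where f: "inj_on f (pverts G)" "pverts H = f ` pverts G" "parcs H = map_prod f f ` parcs G"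
      using digraph_iso_with_proj_iff[OF G.pair_wf_digraph_axioms, THEN iffD1, OF iso] by (elim exE conjE)
    let ?\<phi> = "restrict f (pverts G)"
    have "?\<phi> \<in> inj_homs (pverts G)"
      using f sub by (auto simp: inj_homs_def homs_def image_subset_iff)
    moreover have "map_prod ?\<phi> ?\<phi> e = map_prod f f e" if "e \<in> parcs G" for e
      using that G.in_arcsD1 G.in_arcsD2 by (cases e) auto
    then have "H = \<lparr>pverts = ?\<phi> ` pverts G, parcs = map_prod ?\<phi> ?\<phi> ` parcs G\<rparr>"
      using f by (intro pair_pre_digraph.equality) (simp_all cong: image_cong)
    ultimately show "H \<in> (\<lambda>\<phi>. \<lparr>pverts = \<phi> ` pverts G, parcs = map_prod \<phi> \<phi> ` parcs G\<rparr>) ` inj_homs (pverts G)"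
      by blast
  qed
  then have "card (unit_distance_copies G P) \<le> card (inj_homs (pverts G))"
    by (intro surj_card_le finite_inj_homs) auto
  also have "real (card (inj_homs (pverts G)))
      \<le> 8 ^ k * real (card P) powr (real k - real (\<Sum>v\<in>pverts G. deg (pverts G) v) / 6)"
    using card_inj_homs_le[of "pverts G"] deg G(3) by simp
  also have "real k - real (\<Sum>v\<in>pverts G. deg (pverts G) v) / 6 = real k / 2"
    using deg G(3) by simp
  finally show ?thesis by simp
qed

theorem theorem3:
  fixes G :: "'a pair_pre_digraph" and k :: nat
  assumes "pair_graph G" and "regular 3 G" and "card (pverts G) = k"
  shows "(\<lambda>n. real (max_unit_distance_copies G n)) \<in> soft_bigo (\<lambda>n. real n powr (real k / 2))"
proof -
  \<comment> \<open>\<open>soft_bigo\<close> asks for a positive power of the logarithm; the power 1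
    is taken, and \<open>3 \<le> n\<close> ensures that the logarithm is at least 1.\<close>
  have "real (max_unit_distance_copies G n) \<le> 8 ^ k * real n powr (real k / 2) * ln (real n) powr 1"
    if "3 \<le> n" for n
  proof -
    have "max_unit_distance_copies G n
        \<in> {card (unit_distance_copies G P) | P :: (real ^ 3) set. finite P \<and> card P = n}"
      unfolding max_unit_distance_copies_def
      by (rule Max_in[OF finite_nonempty_unit_distance_counts])
    then obtain P :: "(real ^ 3) set" where P: "finite P" "card P = n"
      "max_unit_distance_copies G n = card (unit_distance_copies G P)"
      by (elim CollectE exE conjE)
    then have "P \<noteq> {}" using that by auto
    have "exp 1 \<le> real n" using exp_le that by linarith
    then have "1 \<le> ln (real n)" using that by (simp add: ln_ge_iff)
    have "real (max_unit_distance_copies G n) \<le> 8 ^ k * real n powr (real k / 2)"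
      using card_unit_distance_copies_le[OF assms P(1) \<open>P \<noteq> {}\<close>] P by simp
    also have "\<dots> \<le> 8 ^ k * real n powr (real k / 2) * ln (real n) powr 1"
      using \<open>1 \<le> ln (real n)\<close> mult_left_mono[of 1 "ln (real n)" "8 ^ k * real n powr (real k / 2)"]
      by simp
    finally show ?thesis .
  qed
  then show ?thesis
    unfolding soft_bigo_def
    by (intro CollectI exI[of _ "8 ^ k"] exI[of _ 1] conjI eventually_sequentiallyI[of 3]) auto
qed

end
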